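(* Let $k$ be a positive integer, let $Q$ be an arbitrary integral quadratic form, and let $f(z,q)\in I_k$. Then $\mathcal{L}_Q(f)$ is divisible by $X_k$, i.e. $$\mathcal{L}_Q(f)\in X_k\,\mathbb{Z}[q^{\pm1}].$$
   Context: $q,z$ are formal variables and $(z;q)_k=\prod_{i=0}^{k-1}(1-q^iz)$. $I_k$ is the ideal of $\mathbb{Z}[z^{\pm1},q^{\pm1}]$ generated by $(q^az;q)_k$ for all $a\in\mathbb{Z}$. An integral quadratic form is a map $Q:\mathbb{Z}\to\mathbb{Z}$ of the form $Q(n)=a_2n^2+a_1n+a_0$ with integers $a_2,a_1,a_0$ (no $a_i$ is required to be nonzero). $\mathcal{L}_Q:\mathbb{Z}[z^{\pm1},q^{\pm1}]\to\mathbb{Z}[q^{\pm1}]$ is the $\mathbb{Z}[q^{\pm1}]$-linear map with $\mathcal{L}_Q(z^j)=q^{Q(j)}$ for all $j\in\mathbb{Z}$. For a positive integer $k$, $$X_k=\frac{(q;q)_k}{(q;q)_{\lfloor k/2\rfloor}}=\prod_{j=\lfloor k/2\rfloor+1}^k(1-q^j).$$ *)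

theory Defs
  imports Complex_Main "HOL-Library.Poly_Mapping"
begin

text \<open>
  Laurent polynomial rings are group rings of the additive group of integers: finitely supported
  maps from exponents to coefficients, with the convolution product. The ring
  \<open>\<int>[z\<^sup>\<plusminus>\<^sup>1, q\<^sup>\<plusminus>\<^sup>1]\<close> is represented as \<open>(\<int>[q\<^sup>\<plusminus>\<^sup>1])[z\<^sup>\<plusminus>\<^sup>1]\<close>, so \<open>single j (single a c)\<close> stands for \<open>c q\<^sup>a z\<^sup>j\<close>.
\<close>

type_synonym laurent_q = "int \<Rightarrow>\<^sub>0 int"
type_synonym laurent_zq = "int \<Rightarrow>\<^sub>0 laurent_q"

definition q_pow :: "int \<Rightarrow> laurent_q" where
  "q_pow a = Poly_Mapping.single a 1"

definition z_pow :: "int \<Rightarrow> laurent_zq" where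
  "z_pow j = Poly_Mapping.single j 1"

definition const_q :: "laurent_q \<Rightarrow> laurent_zq" where
  "const_q c = Poly_Mapping.single 0 c"

text \<open>\<open>qpoch x q k\<close> is \<open>(x;q)\<^sub>k\<close>.\<close>

definition qpoch :: "'a::comm_ring_1 \<Rightarrow> 'a \<Rightarrow> nat \<Rightarrow> 'a" where
  "qpoch x q k = (\<Prod>i<k. 1 - q ^ i * x)"

text \<open>The ideal generated by a set is its span in the ring regarded as a module over itself.\<close>

definition I_ideal :: "nat \<Rightarrow> laurent_zq set" where
  "I_ideal k = module.span (*)
     (range (\<lambda>a::int. qpoch (const_q (q_pow a) * z_pow 1) (const_q (q_pow 1)) k))"

definition integral_quadratic_form :: "(int \<Rightarrow> int) \<Rightarrow> bool" where
  "integral_quadratic_form Q \<longleftrightarrow>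
     (\<exists>a\<^sub>2 a\<^sub>1 a\<^sub>0 :: int. \<forall>n. Q n = a\<^sub>2 * n\<^sup>2 + a\<^sub>1 * n + a\<^sub>0)"

definition L_map :: "(int \<Rightarrow> int) \<Rightarrow> laurent_zq \<Rightarrow> laurent_q" where
  "L_map Q f = (\<Sum>j\<in>Poly_Mapping.keys f. Poly_Mapping.lookup f j * q_pow (Q j))"

definition X_poly :: "nat \<Rightarrow> laurent_q" where
  "X_poly k = (\<Prod>j\<in>{k div 2 + 1..k}. 1 - q_pow (int j))"

lemma q_pow_0: "q_pow 0 = 1"
  by (simp add: q_pow_def)

lemma q_pow_add: "q_pow (a + b) = q_pow a * q_pow b"
  by (simp add: q_pow_def mult_single)

lemma q_pow_of_nat: "q_pow (int n) = q_pow 1 ^ n"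
  by (induction n) (simp_all add: q_pow_0 q_pow_add mult.commute)

lemma z_pow_0: "z_pow 0 = 1"
  by (simp add: z_pow_def)

lemma z_pow_add: "z_pow (i + j) = z_pow i * z_pow j"
  by (simp add: z_pow_def mult_single)

lemma module_times: "module ((*) :: 'a::comm_ring_1 \<Rightarrow> 'a \<Rightarrow> 'a)"
  by unfold_locales (simp_all add: algebra_simps)

lemma L_map_superset:
  assumes "finite A" "Poly_Mapping.keys f \<subseteq> A"
  shows "L_map Q f = (\<Sum>j\<in>A. Poly_Mapping.lookup f j * q_pow (Q j))"
  unfolding L_map_def using assms
  by (intro sum.mono_neutral_left) (auto simp: in_keys_iff)

text \<open>\<open>L_map Q\<close> is the unique \<open>\<int>[q\<^sup>\<plusminus>\<^sup>1]\<close>-linear map sending \<open>z\<^sup>j\<close> to \<open>q\<^bsup>Q(j)\<^esup>\<close>.\<close>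

lemma L_map_z_pow: "L_map Q (z_pow j) = q_pow (Q j)"
  by (simp add: L_map_def z_pow_def)

lemma L_map_add: "L_map Q (f + g) = L_map Q f + L_map Q g"
proof -
  let ?A = "Poly_Mapping.keys f \<union> Poly_Mapping.keys g"
  have "Poly_Mapping.keys (f + g) \<subseteq> ?A"
    by (rule keys_add)
  then show ?thesis
    by (simp add: L_map_superset[of ?A] lookup_add distrib_right sum.distrib)
qed

lemma lookup_const_q_mult: "Poly_Mapping.lookup (const_q c * f) j = c * Poly_Mapping.lookup f j"
  unfolding const_q_def mult_map_scale_conv_mult[symmetric]
  by (simp add: Poly_Mapping.map.rep_eq when_def)

lemma L_map_const_q_mult: "L_map Q (const_q c * f) = c * L_map Q f"
proof -
  have "Poly_Mapping.keys (const_q c * f) \<subseteq> Poly_Mapping.keys f"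
    by (auto simp: in_keys_iff lookup_const_q_mult)
  then show ?thesis
    by (simp add: L_map_superset[of "Poly_Mapping.keys f"] lookup_const_q_mult
        sum_distrib_left mult.assoc)
qed

lemma laurent_zq_expand:
  "f = (\<Sum>j\<in>Poly_Mapping.keys f. const_q (Poly_Mapping.lookup f j) * z_pow j)"
  by (rule poly_mapping_eqI)
     (auto simp: lookup_sum const_q_def z_pow_def mult_single lookup_single when_def in_keys_iff)

lemma L_map_unique:
  assumes add: "\<And>f g. L (f + g) = L f + L g"
    and scale: "\<And>c f. L (const_q c * f) = c * L f"
    and mon: "\<And>j. L (z_pow j) = q_pow (Q j)"
  shows "L = L_map Q"
proof
  fix f
  interpret additive L
    by unfold_locales (rule add)
  show "L f = L_map Q f"
    by (subst laurent_zq_expand) (simp add: sum scale mon L_map_def)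
qed

lemma X_poly_eq_quotient:
  "X_poly k * qpoch (q_pow 1) (q_pow 1) (k div 2) = qpoch (q_pow 1) (q_pow 1) k"
proof -
  have *: "qpoch (q_pow 1) (q_pow 1) n = (\<Prod>j\<in>{1..n}. 1 - q_pow (int j))" for n
    by (induction n) (simp_all add: qpoch_def q_pow_of_nat q_pow_add mult.commute del: of_nat_Suc)
  have "{1..k} = {k div 2 + 1..k} \<union> {1..k div 2}"
    by auto
  then show ?thesis
    unfolding * X_poly_def by (simp add: prod.union_disjoint)
qed

end

theory Submission
  imports Defs
begin

text \<open>
  By linearity and the \<open>q\<close>-binomial theorem, everything reduces to the sums
  \<open>\<Sum>\<^sub>i (-1)\<^sup>i q\<^bsup>i(i-1)/2 + a i\<^sup>2 + b i\<^esup> [k, i]\<close>, the values \<open>\<L>\<^sub>Q((z;q)\<^sub>k)\<close> for \<open>Q(n) = a n\<^sup>2 + b n\<close>.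
  For \<open>a = 0\<close> such a sum is \<open>(q\<^sup>b;q)\<^sub>k\<close>, which is divisible by \<open>(q;q)\<^sub>k\<close>. A finite form of the Bailey
  lemma changes \<open>a\<close> by one: it writes \<open>q\<^bsup>\<plusminus>i(k-i)\<^esup> [k, i]\<close> as a combination of the \<open>[k-2s, i-s]\<close> with
  coefficients divisible by \<open>(q;q)\<^sub>k / ((q;q)\<^sub>s (q;q)\<^bsub>k-2s\<^esub>)\<close>, and the latter times \<open>X\<^bsub>k-2s\<^esub>\<close> is
  \<open>X\<^sub>k\<close> times the \<open>q\<close>-binomial coefficient \<open>[\<lfloor>k/2\<rfloor>, s]\<close>.
\<close>

section \<open>Gaussian binomials and the q-binomial theorem in a commutative ring\<close>

text \<open>The q-Pascal recurrence avoids division, so \<open>q\<close> may be any ring element: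
  below it is the variable, its inverse, or its image in \<open>laurent_zq\<close>.\<close>

fun gauss :: "'a::comm_ring_1 \<Rightarrow> nat \<Rightarrow> nat \<Rightarrow> 'a" where
  "gauss q n 0 = 1"
| "gauss q 0 (Suc k) = 0"
| "gauss q (Suc n) (Suc k) = gauss q n k + q ^ Suc k * gauss q n (Suc k)"

lemma gauss_eq_0: "n < k \<Longrightarrow> gauss q n k = 0"
  by (induction q n k rule: gauss.induct) auto

lemma gauss_self: "gauss q n n = 1"
  by (induction n) (simp_all add: gauss_eq_0)

lemma qpoch_0: "qpoch x q 0 = 1"
  by (simp add: qpoch_def)

lemma qpoch_Suc: "qpoch x q (Suc n) = qpoch x q n * (1 - q ^ n * x)"
  by (simp add: qpoch_def)

text \<open>The quotient formula with denominators cleared. The q-Pascal rule reduces it to 1 -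
  q^(k+l) = (1 - q^k) + q^k (1 - q^l).\<close>

lemma gauss_mult_qpoch:
  "gauss q (k + l) k * qpoch q q k * qpoch q q l = qpoch q q (k + l)"
proof (induction "k + l" arbitrary: k l)
  case 0
  then show ?case by (simp add: qpoch_0)
next
  case (Suc n)
  show ?case
  proof (cases "k = 0 \<or> l = 0")
    case True
    then show ?thesis by (auto simp: gauss_self qpoch_0)
  next
    case False
    then obtain i j where k: "k = Suc i" and l: "l = Suc j"
      by (metis not0_implies_Suc)
    have n: "n = i + l" "n = k + j"
      using Suc.hyps(2) k l by auto
    have "gauss q (k + l) k = gauss q (i + l) i + q ^ k * gauss q (k + j) k"
      using k l by simp
    then have "gauss q (k + l) k * qpoch q q k * qpoch q q l =
        (gauss q (i + l) i * qpoch q q i * qpoch q q l) * (1 - q ^ k)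
        + q ^ k * (gauss q (k + j) k * qpoch q q k * qpoch q q j) * (1 - q ^ l)"
      unfolding k l qpoch_Suc by (simp add: algebra_simps)
    also have "\<dots> = qpoch q q n * (1 - q ^ k) + q ^ k * qpoch q q n * (1 - q ^ l)"
      using Suc.hyps(1)[of i l] Suc.hyps(1)[of k j] n by simp
    also have "\<dots> = qpoch q q n * (1 - q ^ (k + l))"
      by (simp add: algebra_simps power_add)
    also have "\<dots> = qpoch q q (k + l)"
      using Suc.hyps(2) by (metis qpoch_Suc power_Suc2)
    finally show ?thesis .
  qed
qed

text \<open>Moves the q-Pascal rule onto the weights \<open>g\<close>, so that expansions in
  Gaussian binomials follow by induction on \<open>n\<close>.\<close>

lemma sum_gauss_Suc:
  "(\<Sum>s\<le>Suc n. gauss q (Suc n) s * g s) =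
     (\<Sum>s\<le>n. gauss q n s * (q ^ s * g s + g (Suc s)))"
proof -
  \<comment> \<open>The added term vanishes since \<open>gauss q n (Suc n) = 0\<close>; it makes the
    index shift match the range \<open>s \<le> n\<close>.\<close>
  have "(\<Sum>s\<le>n. gauss q n s * (q ^ s * g s)) = (\<Sum>s\<le>Suc n. gauss q n s * (q ^ s * g s))"
    by (simp add: gauss_eq_0)
  also have "\<dots> = g 0 + (\<Sum>s\<le>n. gauss q n (Suc s) * (q ^ Suc s * g (Suc s)))"
    by (subst sum.atMost_Suc_shift) simp
  finally show ?thesis
    by (subst sum.atMost_Suc_shift) (simp add: algebra_simps sum.distrib)
qed

text \<open>
  Specialised to \<open>x = q\<^sup>l\<close> and, with \<open>q\<close> inverted, to \<open>x = q\<^bsup>-l\<^esup>\<close>, this provides both directions of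
  the recursion in \<open>a\<close>.
\<close>

lemma power_eq_sum_gauss:
  "x ^ n = (\<Sum>s\<le>n. gauss q n s * (\<Prod>t<s. x - q ^ t))"
proof (induction n)
  case (Suc n)
  show ?case
    unfolding sum_gauss_Suc by (simp add: Suc algebra_simps sum_distrib_left)
qed simp

lemma choose_two_add: "(m + n) choose 2 = (m choose 2) + m * n + (n choose 2)"
  by (induction m) (simp_all add: numeral_2_eq_2)

text \<open>The q-binomial theorem. Splitting off the factor 1 - x leaves (qx;q)_n, hence the
  induction over arbitrary \<open>x\<close>.\<close>

lemma qpoch_eq_sum_gauss:
  "qpoch x q n = (\<Sum>i\<le>n. gauss q n i * ((-1) ^ i * q ^ (i choose 2) * x ^ i))"
proof (induction n arbitrary: x)
  case 0
  then show ?case by (simp add: qpoch_0 numeral_2_eq_2)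
next
  case (Suc n)
  have "qpoch x q (Suc n) = (1 - x) * qpoch (q * x) q n"
    unfolding qpoch_def by (subst prod.lessThan_Suc_shift) (simp add: algebra_simps)
  also have "\<dots> = (\<Sum>i\<le>n. gauss q n i *
      ((1 - x) * ((-1) ^ i * q ^ (i choose 2) * (q * x) ^ i)))"
    by (simp add: Suc sum_distrib_left algebra_simps)
  also have "\<dots> = (\<Sum>i\<le>Suc n. gauss q (Suc n) i * ((-1) ^ i * q ^ (i choose 2) * x ^ i))"
    unfolding sum_gauss_Suc
    by (intro sum.cong refl arg_cong2[where f = "(*)"])
      (simp add: choose_two_add[of 1, simplified] numeral_2_eq_2 power_add power_mult_distrib algebra_simps)
  finally show ?case .
qed

section \<open>q-factorials and Gaussian binomials in Laurent polynomials\<close>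

abbreviation qq :: laurent_q where "qq \<equiv> q_pow 1"

abbreviation qfact :: "nat \<Rightarrow> laurent_q" where "qfact n \<equiv> qpoch qq qq n"

abbreviation qbin :: "nat \<Rightarrow> nat \<Rightarrow> laurent_q" where "qbin n k \<equiv> gauss qq n k"

lemma q_pow_power: "q_pow a ^ n = q_pow (a * int n)"
  by (induction n) (simp_all add: q_pow_0 q_pow_add[symmetric] algebra_simps)

lemma q_pow_eq_1_iff: "q_pow a = 1 \<longleftrightarrow> a = 0"
proof
  assume "q_pow a = 1"
  then have "Poly_Mapping.lookup (q_pow a) a = Poly_Mapping.lookup 1 a"
    by simp
  then show "a = 0"
    by (simp add: q_pow_def lookup_one when_def split: if_splits)
qed (simp add: q_pow_0)

lemma qfact_Suc: "qfact (Suc n) = qfact n * (1 - q_pow (int (Suc n)))"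
  by (simp add: qpoch_Suc q_pow_of_nat del: of_nat_Suc)

text \<open>Allows q-factorials to be cancelled, which replaces division in the identities
  below.\<close>

lemma qfact_neq_0: "qfact n \<noteq> 0"
proof (induction n)
  case (Suc n)
  have "1 \<noteq> q_pow (int (Suc n))"
    using q_pow_eq_1_iff[of "int (Suc n)"] by auto
  with Suc show ?case
    unfolding qfact_Suc by simp
qed (simp add: qpoch_0)

lemma qbin_mult_qfact: "k \<le> n \<Longrightarrow> qbin n k * qfact k * qfact (n - k) = qfact n"
  using gauss_mult_qpoch[of qq k "n - k"] by simp

text \<open>The second q-Pascal rule, with the power of q on the other term. After clearing
  denominators it is 1 - q^(n+1) = q^(n-k) (1 - q^(k+1)) + (1 - q^(n-k)).\<close>

lemma qbin_Suc_Suc': "k \<le> n \<Longrightarrow> qbin (Suc n) (Suc k) = q_pow (int n - int k) * qbin n k + qbin n (Suc k)"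
proof (cases "k = n")
  case True
  then show ?thesis by (simp add: gauss_self gauss_eq_0 q_pow_0)
next
  case False
  assume "k \<le> n"
  with False obtain m where n: "n = Suc (k + m)"
    using less_imp_Suc_add[of k n] by force
  have 1: "qbin (Suc n) (Suc k) * qfact (Suc k) * qfact (Suc m) = qfact n * (1 - q_pow (int (Suc n)))"
    using qbin_mult_qfact[of "Suc k" "Suc n"] qfact_Suc[of n] n by (simp del: gauss.simps of_nat_Suc)
  have 2: "qbin n (Suc k) * qfact (Suc k) * qfact m = qfact n"
    using qbin_mult_qfact[of "Suc k" n] n by simp
  have 3: "qbin n k * qfact k * qfact (Suc m) = qfact n"
    using qbin_mult_qfact[of k n] n by (simp add: Suc_diff_le)
  have nk: "int n - int k = int (Suc m)"
    using n by simp
  have sp: "q_pow (int (Suc n)) = q_pow (int (Suc m)) * q_pow (int (Suc k))"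
    using n by (simp add: q_pow_add[symmetric] add_ac)
  have "(q_pow (int (Suc m)) * qbin n k + qbin n (Suc k)) * qfact (Suc k) * qfact (Suc m)
      = q_pow (int (Suc m)) * (qbin n k * qfact k * qfact (Suc m)) * (1 - q_pow (int (Suc k)))
      + (qbin n (Suc k) * qfact (Suc k) * qfact m) * (1 - q_pow (int (Suc m)))"
    by (simp add: qfact_Suc algebra_simps del: of_nat_Suc)
  also have "\<dots> = qfact n * (1 - q_pow (int (Suc n)))"
    unfolding 2 3 sp by (simp add: algebra_simps del: of_nat_Suc)
  finally have "(q_pow (int (Suc m)) * qbin n k + qbin n (Suc k)) * (qfact (Suc k) * qfact (Suc m)) =
      qbin (Suc n) (Suc k) * (qfact (Suc k) * qfact (Suc m))"
    using 1 by (simp only: mult.assoc)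
  then show ?thesis
    unfolding nk using mult_right_cancel[of "qfact (Suc k) * qfact (Suc m)"] qfact_neq_0
    by (simp only: mult_eq_0_iff simp_thms)
qed

text \<open>Inverting q turns the defining q-Pascal rule into the second one, up to the stated power
  of q.\<close>

lemma gauss_q_inverse:
  "k \<le> n \<Longrightarrow> gauss (q_pow (- 1)) n k = q_pow (- (int k * (int n - int k))) * qbin n k"
proof (induction n arbitrary: k)
  case (Suc n)
  show ?case
  proof (cases k)
    case (Suc j)
    have j: "j \<le> n" using Suc Suc.prems by simp
    have "gauss (q_pow (- 1)) (Suc n) (Suc j) = q_pow (- (int j * (int n - int j))) * qbin n j
       + q_pow (- int (Suc j)) * gauss (q_pow (- 1)) n (Suc j)"
      using Suc.IH[OF j] by (simp add: q_pow_power flip: power_Suc)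
    also have "gauss (q_pow (- 1)) n (Suc j) = q_pow (- (int (Suc j) * (int n - int (Suc j)))) * qbin n (Suc j)"
      using Suc.IH[of "Suc j"] by (cases "Suc j \<le> n") (simp_all add: gauss_eq_0)
    finally have eq: "gauss (q_pow (- 1)) (Suc n) (Suc j) = q_pow (- (int j * (int n - int j))) * qbin n j
       + q_pow (- int (Suc j)) * (q_pow (- (int (Suc j) * (int n - int (Suc j)))) * qbin n (Suc j))" .
    let ?E = "q_pow (- (int (Suc j) * (int (Suc n) - int (Suc j))))"
    have "q_pow (- int (Suc j)) * q_pow (- (int (Suc j) * (int n - int (Suc j)))) = ?E"
      "?E * q_pow (int n - int j) = q_pow (- (int j * (int n - int j)))"
      unfolding q_pow_add[symmetric] by (simp_all add: algebra_simps)
    then show ?thesis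
      unfolding Suc qbin_Suc_Suc'[OF j] eq by (simp only: distrib_left mult.assoc[symmetric])
  qed (simp add: q_pow_0)
qed (simp add: q_pow_0)

section \<open>Expansions of q^(il) and q^(-il)\<close>

text \<open>For \<open>s > l\<close> both sides are 0, the product because of its factor at
  \<open>t = l\<close>.\<close>

lemma qbin_mult_qfact_prod: "qbin l s * qfact s = (\<Prod>t<s. 1 - q_pow (int l - int t))"
proof (cases "s \<le> l")
  case True
  then show ?thesis
  proof (induction s)
    case (Suc s)
    have "qfact (l - s) = qfact (l - Suc s) * (1 - q_pow (int l - int s))"
      using Suc.prems qfact_Suc[of "l - Suc s"] by (simp add: Suc_diff_Suc of_nat_diff)
    then have "qbin l s * qfact s * (1 - q_pow (int l - int s)) * qfact (l - Suc s) =
       qbin l s * qfact s * qfact (l - s)"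
      by (simp only: mult_ac)
    also have "\<dots> = qbin l (Suc s) * qfact (Suc s) * qfact (l - Suc s)"
      using Suc.prems qbin_mult_qfact[of s l] by (simp only: qbin_mult_qfact Suc_leD)
    finally have "qbin l s * qfact s * (1 - q_pow (int l - int s)) = qbin l (Suc s) * qfact (Suc s)"
      by (rule mult_right_cancel[THEN iffD1, rotated]) (simp add: qfact_neq_0)
    then show ?case using Suc by simp
  qed (simp add: qpoch_0)
next
  case False
  then have "(\<Prod>t<s. 1 - q_pow (int l - int t)) = 0"
    by (intro prod_zero bexI[of _ l]) (auto simp: q_pow_0)
  then show ?thesis using False by (simp add: gauss_eq_0)
qed

text \<open>This is \<open>power_eq_sum_gauss\<close> at x = q^l; pulling -q^t out of each factor
  produces the sign and the exponent \<open>s choose 2\<close>.\<close>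

lemma q_pow_mult_eq_sum:
  "q_pow (int i * int l) =
     (\<Sum>s\<le>i. (- 1) ^ s * q_pow (int (s choose 2)) * qbin i s * qbin l s * qfact s)"
proof -
  have *: "(\<Prod>t<s. q_pow (int l) - qq ^ t) =
      (- 1) ^ s * q_pow (int (s choose 2)) * (\<Prod>t<s. 1 - q_pow (int l - int t))" for s
  proof (induction s)
    case (Suc s)
    have "q_pow (int l) - qq ^ s = - q_pow (int s) * (1 - q_pow (int l - int s))"
      by (simp add: algebra_simps q_pow_add[symmetric] q_pow_of_nat[symmetric])
    moreover have "q_pow (int (Suc s choose 2)) = q_pow (int (s choose 2)) * q_pow (int s)"
      by (simp add: q_pow_add[symmetric] numeral_2_eq_2 add.commute)
    ultimately show ?case by (simp only: Suc prod.lessThan_Suc power_Suc) (simp only: mult_ac mult_minus_left mult_minus_right mult_1)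
  qed (simp add: q_pow_0 numeral_2_eq_2)
  have "q_pow (int i * int l) = q_pow (int l) ^ i"
    by (simp add: q_pow_power mult.commute)
  also have "\<dots> = (\<Sum>s\<le>i. qbin i s * (\<Prod>t<s. q_pow (int l) - qq ^ t))"
    by (rule power_eq_sum_gauss)
  finally show ?thesis
    unfolding * qbin_mult_qfact_prod[symmetric] by (simp add: mult_ac)
qed

text \<open>The same with q inverted. The factors q^(-s(i-s)) from \<open>gauss_q_inverse\<close>
  and q^(-sl) from the product combine to a coefficient depending only on \<open>s\<close> and
  \<open>i + l\<close>.\<close>

lemma q_pow_neg_mult_eq_sum:
  "q_pow (- (int i * int l)) =
     (\<Sum>s\<le>i. q_pow (- (int s * (int (i + l) - int s))) * qbin i s * qbin l s * qfact s)"
proof -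
  have *: "(\<Prod>t<s. q_pow (- int l) - q_pow (- 1) ^ t) =
      q_pow (- (int s * int l)) * (\<Prod>t<s. 1 - q_pow (int l - int t))" for s
  proof (induction s)
    case (Suc s)
    have "q_pow (- int l) - q_pow (- 1) ^ s = q_pow (- int l) * (1 - q_pow (int l - int s))"
      by (simp add: algebra_simps q_pow_add[symmetric] q_pow_power)
    moreover have "q_pow (- (int (Suc s) * int l)) = q_pow (- (int s * int l)) * q_pow (- int l)"
      by (simp add: q_pow_add[symmetric] algebra_simps)
    ultimately show ?case by (simp add: Suc algebra_simps del: of_nat_Suc)
  qed (simp add: q_pow_0)
  have "q_pow (- (int i * int l)) = q_pow (- int l) ^ i"
    by (simp add: q_pow_power mult.commute)
  also have "\<dots> = (\<Sum>s\<le>i. gauss (q_pow (- 1)) i s * (\<Prod>t<s. q_pow (- int l) - q_pow (- 1) ^ t))"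
    by (rule power_eq_sum_gauss)
  also have "\<dots> = (\<Sum>s\<le>i. q_pow (- (int s * (int (i + l) - int s))) * qbin i s * qbin l s * qfact s)"
  proof (rule sum.cong[OF refl])
    fix s assume "s \<in> {..i}"
    have "q_pow (- (int s * (int (i + l) - int s))) = q_pow (- (int s * (int i - int s))) * q_pow (- (int s * int l))"
      by (simp add: q_pow_add[symmetric] algebra_simps)
    then show "gauss (q_pow (- 1)) i s * (\<Prod>t<s. q_pow (- int l) - q_pow (- 1) ^ t) =
       q_pow (- (int s * (int (i + l) - int s))) * qbin i s * qbin l s * qfact s"
      unfolding * qbin_mult_qfact_prod[symmetric] using \<open>s \<in> {..i}\<close>
      by (simp add: gauss_q_inverse mult_ac)
  qed
  finally show ?thesis .
qed

section \<open>The Bailey-type kernel\<close>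

text \<open>\<open>bailey k s\<close> is \<open>(q;q)\<^sub>k / ((q;q)\<^sub>s (q;q)\<^bsub>k-2s\<^esub>)\<close>, written without division.\<close>

definition bailey :: "nat \<Rightarrow> nat \<Rightarrow> laurent_q" where
  "bailey k s = qbin k (2 * s) * X_poly (2 * s)"

lemma bailey_eq_0: "k < 2 * s \<Longrightarrow> bailey k s = 0"
  by (simp add: bailey_def gauss_eq_0)

lemma bailey_mult_qfact:
  assumes "2 * s \<le> k"
  shows "bailey k s * qfact s * qfact (k - 2 * s) = qfact k"
proof -
  have "bailey k s * qfact s * qfact (k - 2 * s) =
      qbin k (2 * s) * (X_poly (2 * s) * qfact (2 * s div 2)) * qfact (k - 2 * s)"
    by (simp add: bailey_def mult_ac)
  then show ?thesis
    unfolding X_poly_eq_quotient using qbin_mult_qfact[OF assms] by simp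
qed

text \<open>The cofactor is \<open>qbin (k div 2) s\<close>: multiplied by
  \<open>qfact s * qfact (k div 2 - s)\<close>, both sides become \<open>qfact k\<close>.\<close>

lemma X_poly_dvd_bailey:
  assumes "2 * s \<le> k"
  shows "X_poly k dvd bailey k s * X_poly (k - 2 * s)"
proof -
  let ?h = "k div 2"
  have s: "s \<le> ?h" using assms by simp
  have d: "(k - 2 * s) div 2 = ?h - s" using assms by simp
  have "bailey k s * X_poly (k - 2 * s) * (qfact s * qfact (?h - s)) =
      bailey k s * qfact s * (X_poly (k - 2 * s) * qfact ((k - 2 * s) div 2))"
    unfolding d by (simp add: mult_ac)
  also have "\<dots> = X_poly k * qfact ?h"
    unfolding X_poly_eq_quotient by (rule bailey_mult_qfact[OF assms])
  also have "\<dots> = X_poly k * qbin ?h s * (qfact s * qfact (?h - s))"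
    using qbin_mult_qfact[OF s] by (simp add: mult_ac)
  finally have "bailey k s * X_poly (k - 2 * s) = X_poly k * qbin ?h s"
    by (rule mult_right_cancel[THEN iffD1, rotated]) (simp add: qfact_neq_0)
  then show ?thesis by simp
qed

text \<open>The abstract \<open>c\<close> covers both expansions. Since it sees only
  \<open>i + l = k\<close>, the coefficients do not depend on \<open>i\<close> and can leave a sum
  over \<open>i\<close>.\<close>

lemma bailey_kernel:
  assumes c: "\<And>i l. q_pow (e * (int i * int l)) =
      (\<Sum>s\<le>i. c (i + l) s * qbin i s * qbin l s * qfact s)"
    and "i \<le> k"
  shows "q_pow (e * (int i * (int k - int i))) * qbin k i =
    (\<Sum>s\<le>i. c k s * bailey k s * qbin (k - 2 * s) (i - s))"
proof -
  obtain l where k: "k = i + l" using \<open>i \<le> k\<close> le_Suc_ex by blast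
  let ?u = "qfact i * qfact l"
  have summand: "bailey k s * qbin (k - 2 * s) (i - s) * ?u = qfact k * qbin i s * qbin l s * qfact s"
    if "s \<le> i" for s
  proof (cases "s \<le> l")
    case True
    have "?u = (qbin i s * qfact s * qfact (i - s)) * (qbin l s * qfact s * qfact (l - s))"
      using that True by (simp only: qbin_mult_qfact)
    then have "bailey k s * qbin (k - 2 * s) (i - s) * ?u = bailey k s * qbin (k - 2 * s) (i - s) *
        ((qbin i s * qfact s * qfact (i - s)) * (qbin l s * qfact s * qfact (l - s)))"
      by (rule arg_cong)
    also have "\<dots> = bailey k s * qfact s * (qbin (k - 2 * s) (i - s) * qfact (i - s) * qfact (l - s)) *
        qbin i s * qbin l s * qfact s"
      by (simp add: mult_ac)
    also have "qbin (k - 2 * s) (i - s) * qfact (i - s) * qfact (l - s) = qfact (k - 2 * s)"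
      using qbin_mult_qfact[of "i - s" "k - 2 * s"] that True k by (simp add: mult_2)
    also have "bailey k s * qfact s * qfact (k - 2 * s) = qfact k"
      using that True k by (intro bailey_mult_qfact) simp
    finally show ?thesis .
  next
    case False
    \<comment> \<open>If \<open>k < 2 * s\<close>, the truncated \<open>k - 2 * s\<close> is 0 and
      the binomial need not vanish, but \<open>bailey k s\<close> does.\<close>
    have "bailey k s * qbin (k - 2 * s) (i - s) = 0"
    proof (cases "k < 2 * s")
      case False
      then have "k - 2 * s < i - s" using \<open>\<not> s \<le> l\<close> that k by simp
      then show ?thesis by (simp add: gauss_eq_0)
    qed (simp add: bailey_eq_0)
    then show ?thesis using False by (simp add: gauss_eq_0)
  qed
  have "q_pow (e * (int i * (int k - int i))) * qbin k i * ?u = q_pow (e * (int i * int l)) * qfact k"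
    using qbin_mult_qfact[of i k] k by (simp add: mult_ac)
  also have "\<dots> = (\<Sum>s\<le>i. c k s * (qfact k * qbin i s * qbin l s * qfact s))"
    unfolding c k by (simp add: sum_distrib_left mult_ac)
  also have "\<dots> = (\<Sum>s\<le>i. c k s * (bailey k s * qbin (k - 2 * s) (i - s) * ?u))"
    by (intro sum.cong refl) (simp add: summand)
  also have "\<dots> = (\<Sum>s\<le>i. c k s * bailey k s * qbin (k - 2 * s) (i - s)) * ?u"
    unfolding sum_distrib_right by (intro sum.cong refl) (simp only: mult.assoc)
  finally show ?thesis
    by (rule mult_right_cancel[THEN iffD1, rotated]) (simp add: qfact_neq_0)
qed

section \<open>Theta sums and the recursion in the quadratic coefficient\<close>

definition theta_sum :: "int \<Rightarrow> int \<Rightarrow> nat \<Rightarrow> laurent_q" where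
  "theta_sum a b k =
     (\<Sum>i\<le>k. (- 1) ^ i * q_pow (int (i choose 2) + a * (int i)\<^sup>2 + b * int i) * qbin k i)"

text \<open>Under i = s + j the cross terms sj and 2asj are linear in j, so only \<open>b\<close>
  changes and \<open>a\<close> stays fixed.\<close>

lemma theta_sum_shifted:
  assumes "2 * s \<le> k"
  shows "(\<Sum>i=s..k. (- 1) ^ i * q_pow (int (i choose 2) + a * (int i)\<^sup>2 + b * int i) * qbin (k - 2 * s) (i - s)) =
    (- 1) ^ s * q_pow (int (s choose 2) + a * (int s)\<^sup>2 + b * int s) * theta_sum a (b + int s + 2 * a * int s) (k - 2 * s)"
proof -
  let ?g = "\<lambda>i. (- 1) ^ i * q_pow (int (i choose 2) + a * (int i)\<^sup>2 + b * int i) * qbin (k - 2 * s) (i - s)"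
  have "(\<Sum>i=s..k. ?g i) = (\<Sum>i=s..k - s. ?g i)"
    using assms by (intro sum.mono_neutral_right) (auto simp: gauss_eq_0)
  also have "\<dots> = (\<Sum>j\<le>k - 2 * s. ?g (s + j))"
    using assms by (intro sum.reindex_bij_witness[of _ "\<lambda>j. s + j" "\<lambda>i. i - s"]) auto
  also have "\<dots> = (- 1) ^ s * q_pow (int (s choose 2) + a * (int s)\<^sup>2 + b * int s) *
      theta_sum a (b + int s + 2 * a * int s) (k - 2 * s)"
    unfolding theta_sum_def sum_distrib_left
  proof (intro sum.cong refl)
    fix j
    have "q_pow (int ((s + j) choose 2) + a * (int (s + j))\<^sup>2 + b * int (s + j)) =
       q_pow (int (s choose 2) + a * (int s)\<^sup>2 + b * int s) *
       q_pow (int (j choose 2) + a * (int j)\<^sup>2 + (b + int s + 2 * a * int s) * int j)"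
      unfolding choose_two_add q_pow_add[symmetric]
      by (intro arg_cong[where f = q_pow]) (simp add: algebra_simps power2_eq_square)
    then show "?g (s + j) = (- 1) ^ s * q_pow (int (s choose 2) + a * (int s)\<^sup>2 + b * int s) *
       ((- 1) ^ j * q_pow (int (j choose 2) + a * (int j)\<^sup>2 + (b + int s + 2 * a * int s) * int j) *
         qbin (k - 2 * s) j)"
      by (simp add: power_add mult_ac)
  qed
  finally show ?thesis .
qed

lemma X_poly_dvd_theta_sum_step:
  assumes c: "\<And>i l. q_pow (e * (int i * int l)) =
      (\<Sum>s\<le>i. c (i + l) s * qbin i s * qbin l s * qfact s)"
    and IH: "\<And>b k. X_poly k dvd theta_sum a b k"
  shows "X_poly k dvd theta_sum (a - e) b k"
proof -
  \<comment> \<open>Chosen so that (a-e)i^2 + bi = ai^2 + b'i + ei(k-i); the last term is what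
    \<open>bailey_kernel\<close> expands.\<close>
  define b' where "b' = b - e * int k"
  let ?E = "\<lambda>i. (- 1) ^ i * q_pow (int (i choose 2) + a * (int i)\<^sup>2 + b' * int i)"
  have "theta_sum (a - e) b k = (\<Sum>i\<le>k. ?E i * (q_pow (e * (int i * (int k - int i))) * qbin k i))"
    unfolding theta_sum_def
  proof (intro sum.cong refl)
    fix i
    have "q_pow (int (i choose 2) + (a - e) * (int i)\<^sup>2 + b * int i) =
      q_pow (int (i choose 2) + a * (int i)\<^sup>2 + b' * int i) * q_pow (e * (int i * (int k - int i)))"
      unfolding q_pow_add[symmetric] b'_def
      by (intro arg_cong[where f = q_pow]) (simp add: algebra_simps power2_eq_square)
    then show "(- 1) ^ i * q_pow (int (i choose 2) + (a - e) * (int i)\<^sup>2 + b * int i) * qbin k i =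
      ?E i * (q_pow (e * (int i * (int k - int i))) * qbin k i)"
      by (simp add: mult_ac)
  qed
  also have "\<dots> = (\<Sum>i\<le>k. \<Sum>s\<le>i. ?E i * (c k s * bailey k s * qbin (k - 2 * s) (i - s)))"
    by (intro sum.cong refl) (simp add: bailey_kernel[OF c] sum_distrib_left)
  also have "\<dots> = (\<Sum>s\<le>k. \<Sum>i=s..k. ?E i * (c k s * bailey k s * qbin (k - 2 * s) (i - s)))"
    unfolding sum.Sigma[OF finite_atMost ballI[OF finite_atMost]]
      sum.Sigma[OF finite_atMost ballI[OF finite_atLeastAtMost]]
    by (rule sum.reindex_bij_witness[of _ "\<lambda>(s, i). (i, s)" "\<lambda>(i, s). (s, i)"]) auto
  also have "\<dots> = (\<Sum>s\<le>k. c k s * bailey k s * (\<Sum>i=s..k. ?E i * qbin (k - 2 * s) (i - s)))"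
    by (simp add: sum_distrib_left mult_ac)
  also have "X_poly k dvd \<dots>"
  proof (rule dvd_sum)
    fix s assume "s \<in> {..k}"
    show "X_poly k dvd c k s * bailey k s * (\<Sum>i=s..k. ?E i * qbin (k - 2 * s) (i - s))"
    proof (cases "2 * s \<le> k")
      case True
      have "X_poly k dvd bailey k s * theta_sum a (b' + int s + 2 * a * int s) (k - 2 * s)"
        using X_poly_dvd_bailey[OF True] IH by (meson dvd_trans mult_dvd_mono dvd_refl)
      then have "X_poly k dvd (c k s * ((- 1) ^ s * q_pow (int (s choose 2) + a * (int s)\<^sup>2 + b' * int s))) *
          (bailey k s * theta_sum a (b' + int s + 2 * a * int s) (k - 2 * s))"
        by (rule dvd_mult)
      then show ?thesis
        unfolding theta_sum_shifted[OF True] by (simp only: mult_ac)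
    qed (simp add: bailey_eq_0)
  qed
  finally show ?thesis .
qed

text \<open>Within the induction on \<open>k\<close>, a second one runs over \<open>b\<close> in
  both directions from 0: consecutive values differ by q^b (1 - q^(k+1)) (q^(b+1);q)_k, which the
  hypothesis for \<open>k\<close> handles.\<close>

lemma qfact_dvd_qpoch: "qfact k dvd qpoch (q_pow b) qq k"
proof (induction k arbitrary: b)
  case (Suc k)
  have eq: "qpoch (q_pow b) qq n = (\<Prod>i<n. 1 - q_pow (b + int i))" for b n
    unfolding qpoch_def by (simp add: q_pow_add q_pow_of_nat mult.commute)
  let ?G = "\<lambda>b. qpoch (q_pow b) qq (Suc k)"
  have diff: "?G (b + 1) - ?G b = q_pow b * (qpoch (q_pow (b + 1)) qq k * (1 - q_pow (int (Suc k))))" for b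
  proof -
    have "?G b = (1 - q_pow b) * qpoch (q_pow (b + 1)) qq k"
      unfolding eq by (subst prod.lessThan_Suc_shift) (simp add: add_ac)
    moreover have "?G (b + 1) = qpoch (q_pow (b + 1)) qq k * (1 - q_pow b * q_pow (int (Suc k)))"
      unfolding qpoch_Suc by (simp add: q_pow_add[symmetric] q_pow_of_nat[symmetric] add_ac)
    ultimately show ?thesis by (simp add: algebra_simps del: of_nat_Suc)
  qed
  have dvd_diff: "qfact (Suc k) dvd ?G (b + 1) - ?G b" for b
    unfolding diff qfact_Suc by (intro dvd_mult mult_dvd_mono Suc dvd_refl)
  show ?case
  proof (induction b rule: int_induct[where k = 0])
    case base
    \<comment> \<open>At \<open>b = 0\<close> the first factor of the product is 0.\<close>
    show ?case unfolding eq by (subst prod.lessThan_Suc_shift) (simp add: q_pow_0)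
  next
    case (step1 i)
    then show ?case using dvd_add[OF dvd_diff[of i]] by fastforce
  next
    case (step2 i)
    then show ?case using dvd_diff[of "i - 1"] by (metis diff_add_cancel dvd_diff_commute dvd_diff_right_iff)
  qed
qed (simp add: qpoch_0)

text \<open>Two-sided induction on \<open>a\<close>, with \<open>b\<close> and \<open>k\<close>
  arbitrary since the recursion alters both. Raising \<open>a\<close> takes \<open>e = - 1\<close>,
  lowering it \<open>e = 1\<close>.\<close>

lemma X_poly_dvd_theta_sum: "X_poly k dvd theta_sum a b k"
proof (induction a arbitrary: b k rule: int_induct[where k = 0])
  case base
  have "theta_sum 0 b k = qpoch (q_pow b) qq k"
    unfolding theta_sum_def qpoch_eq_sum_gauss
    by (intro sum.cong refl) (simp add: q_pow_add q_pow_of_nat q_pow_power[of b, symmetric] mult_ac)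
  moreover have "X_poly k dvd qfact k"
    using X_poly_eq_quotient[of k] by (metis dvd_triv_left)
  ultimately show ?case
    using qfact_dvd_qpoch dvd_trans by metis
next
  case (step1 a)
  have "q_pow (- 1 * (int i * int l)) =
     (\<Sum>s\<le>i. q_pow (- (int s * (int (i + l) - int s))) * qbin i s * qbin l s * qfact s)" for i l
    using q_pow_neg_mult_eq_sum[of i l] by simp
  from X_poly_dvd_theta_sum_step[where e = "- 1" and c = "\<lambda>n s. q_pow (- (int s * (int n - int s)))", OF this step1(2)]
  show ?case by simp
next
  case (step2 a)
  have "q_pow (1 * (int i * int l)) =
     (\<Sum>s\<le>i. (- 1) ^ s * q_pow (int (s choose 2)) * qbin i s * qbin l s * qfact s)" for i l
    using q_pow_mult_eq_sum[of i l] by simp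
  from X_poly_dvd_theta_sum_step[where e = 1 and c = "\<lambda>n s. (- 1) ^ s * q_pow (int (s choose 2))", OF this step2(2)]
  show ?case .
qed

section \<open>From generators of the ideal to theta sums\<close>

lemma const_q_mult: "const_q (a * b) = const_q a * const_q b"
  by (simp add: const_q_def mult_single)

lemma const_q_add: "const_q (a + b) = const_q a + const_q b"
  by (simp add: const_q_def single_add)

lemma const_q_1: "const_q 1 = 1"
  by (simp add: const_q_def)

lemma const_q_power: "const_q (a ^ n) = const_q a ^ n"
  by (induction n) (simp_all add: const_q_1 const_q_mult)

lemma const_q_gauss: "const_q (gauss q n k) = gauss (const_q q) n k"
  by (induction q n k rule: gauss.induct)
    (simp_all add: const_q_1 const_q_mult const_q_add const_q_power, simp_all add: const_q_def)

lemma z_pow_power: "z_pow j ^ n = z_pow (j * int n)"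
  by (induction n) (simp_all add: z_pow_0 z_pow_add[symmetric] algebra_simps)

lemma L_map_sum: "L_map Q (sum f A) = (\<Sum>x\<in>A. L_map Q (f x))"
proof -
  interpret additive "L_map Q" by unfold_locales (rule L_map_add)
  show ?thesis by (rule sum)
qed

text \<open>As Q(j+i) = Q(j) + ai^2 + (2aj+b)i, the monomial z^j and the shift by q^m only affect
  the linear coefficient and a factor q^(Q(j)).\<close>

lemma X_poly_dvd_L_map_z_pow_qpoch:
  assumes "integral_quadratic_form Q"
  shows "X_poly k dvd L_map Q (z_pow j * qpoch (const_q (q_pow m) * z_pow 1) (const_q qq) k)"
proof -
  obtain a b c where Q: "\<And>n. Q n = a * n\<^sup>2 + b * n + c"
    using assms unfolding integral_quadratic_form_def by blast
  have neg: "(- 1 :: laurent_zq) ^ i = const_q ((- 1) ^ i)" for i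
    unfolding const_q_power by (simp add: const_q_def single_uminus)
  have "z_pow j * qpoch (const_q (q_pow m) * z_pow 1) (const_q qq) k =
    (\<Sum>i\<le>k. const_q (qbin k i * (- 1) ^ i * q_pow (int (i choose 2)) * q_pow (m * int i)) * z_pow (j + int i))"
    unfolding qpoch_eq_sum_gauss sum_distrib_left neg
    by (intro sum.cong refl)
      (simp add: const_q_gauss const_q_mult const_q_power q_pow_of_nat q_pow_power[of m, symmetric]
        power_mult_distrib z_pow_add z_pow_power mult_ac)
  then have "L_map Q (z_pow j * qpoch (const_q (q_pow m) * z_pow 1) (const_q qq) k) =
    (\<Sum>i\<le>k. qbin k i * (- 1) ^ i * q_pow (int (i choose 2)) * q_pow (m * int i) * q_pow (Q (j + int i)))"
    by (simp only: L_map_sum L_map_const_q_mult L_map_z_pow)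
  also have "\<dots> = q_pow (Q j) * theta_sum a (2 * a * j + b + m) k"
    unfolding theta_sum_def sum_distrib_left
  proof (intro sum.cong refl)
    fix i
    have "q_pow (int (i choose 2)) * q_pow (m * int i) * q_pow (Q (j + int i)) =
      q_pow (Q j) * q_pow (int (i choose 2) + a * (int i)\<^sup>2 + (2 * a * j + b + m) * int i)"
      unfolding q_pow_add[symmetric] Q
      by (intro arg_cong[where f = q_pow]) (simp add: algebra_simps power2_eq_square)
    then show "qbin k i * (- 1) ^ i * q_pow (int (i choose 2)) * q_pow (m * int i) * q_pow (Q (j + int i)) =
      q_pow (Q j) * ((- 1) ^ i * q_pow (int (i choose 2) + a * (int i)\<^sup>2 + (2 * a * j + b + m) * int i) * qbin k i)"
      by (simp add: mult_ac)
  qed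
  finally show ?thesis
    using X_poly_dvd_theta_sum by simp
qed

theorem theorem2p2:
  fixes k :: nat and Q :: "int \<Rightarrow> int" and f :: laurent_zq
  assumes "0 < k"
    and "integral_quadratic_form Q"
    and "f \<in> I_ideal k"
  shows "X_poly k dvd L_map Q f"
proof -
  let ?P = "\<lambda>m. qpoch (const_q (q_pow m) * z_pow 1) (const_q qq) k"
  \<comment> \<open>\<open>L_map Q\<close> is linear over \<open>laurent_q\<close> but in general
    not multiplicative, so the multiplier \<open>g\<close> is split into monomials in z.\<close>
  have gen: "X_poly k dvd L_map Q (g * ?P m)" for g m
  proof -
    have "g * ?P m = (\<Sum>j\<in>Poly_Mapping.keys g. const_q (Poly_Mapping.lookup g j) * (z_pow j * ?P m))"
      unfolding mult.assoc[symmetric] sum_distrib_right[symmetric]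
      by (rule arg_cong[OF laurent_zq_expand])
    then show ?thesis
      by (simp only: L_map_sum L_map_const_q_mult)
        (intro dvd_sum dvd_mult X_poly_dvd_L_map_z_pow_qpoch[OF assms(2)])
  qed
  interpret module "(*) :: laurent_zq \<Rightarrow> laurent_zq \<Rightarrow> laurent_zq"
    by (rule module_times)
  have "f \<in> span (range ?P)"
    using assms(3) unfolding I_ideal_def .
  then show ?thesis
  proof (induction rule: span_induct_alt)
    case base
    show ?case by (simp add: L_map_def)
  next
    case (step c x y)
    then obtain m where "x = ?P m" by blast
    then show ?case using gen[of c m] step by (simp add: L_map_add)
  qed
qed

end
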